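(* Let $p\in(0,1)$, and let $F$ and $G$ be any two cdf's from $\mathcal{F}^{+}_{1}$. Then $$\int_p^1 \big( G^{-1}(u)-F^{-1}(u) \big)\, du =\int^{\infty }_{F^{-1}(p)} \big( F(x)- G(x)\big)\, dx - \mathrm{Rem}(p;F,G),$$ where the remainder term $$\mathrm{Rem}(p;F,G) =\int^{F^{-1}(p)}_{G^{-1}(p)} \big( G(x)-p\big)\, dx$$ is non-negative, that is, $\mathrm{Rem}(p;F,G)\ge 0$, and satisfies the bounds $$\mathrm{Rem}(p;F,G) \le \int^{F^{-1}(p)}_{G^{-1}(p)} \big( G(x) - F(x)\big)\, dx \le \big| G^{-1}(p)-F^{-1}(p)\big|\,\sup_{x\in \mathbb{R}} \big| G(x) - F(x)\big| .$$
   Context: A cdf is the cumulative distribution function $F(x)=\mathbb{P}(X\le x)$ of a real-valued random variable. The quantile function of a cdf $F$ is $F^{-1}(u)=\inf\{x\in\mathbb{R}: F(x)\ge u\}$ for $u\in(0,1]$ and $F^{-1}(0)=\lim_{u\downarrow 0}F^{-1}(u)$. The class $\mathcal{F}^{+}_{1}$ consists of all cdf's $F$ for which $\int_p^1 F^{-1}(u)\,du$ is finite (for $p\in(0,1)$); equivalently, $\mathbb{E}(X^{+})<\infty$ for $X\sim F$, where $X^{+}=X\vee 0$. Integrals are oriented: $\int_a^b=-\int_b^a$ when $a>b$. *)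

theory Defs
  imports "HOL-Probability.Probability"
begin

definition is_cdf :: "(real \<Rightarrow> real) \<Rightarrow> bool" where
  "is_cdf F \<longleftrightarrow> (\<exists>M. real_distribution M \<and> F = cdf M)"

(* Values are extended reals because the quantile may be \<infinity> at u = 1 and -\<infinity> at u = 0;
   quantile_finite below shows that it is real for 0 < u < 1. Only u in [0,1] is meaningful. *)
definition quantile :: "(real \<Rightarrow> real) \<Rightarrow> real \<Rightarrow> ereal" where
  "quantile F u =
     (if u = 0 then Lim (at_right 0) (\<lambda>v. Inf (ereal ` {x. v \<le> F x}))
      else Inf (ereal ` {x. u \<le> F x}))"

(* Since the quantile function is real-valued on (0,1), real_of_ereal alters the integrand
   at most at the null endpoint u = 1. *)
definition F1plus :: "(real \<Rightarrow> real) set" where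
  "F1plus = {F. is_cdf F \<and>
     (\<forall>p\<in>{0<..<1}. set_integrable lborel {p..1} (\<lambda>u. real_of_ereal (quantile F u)))}"

(* The interval integral is oriented: it changes sign when its bounds are swapped. *)
definition Rem :: "real \<Rightarrow> (real \<Rightarrow> real) \<Rightarrow> (real \<Rightarrow> real) \<Rightarrow> real" where
  "Rem p F G = (LBINT x=quantile G p..quantile F p. G x - p)"

lemma quantile_finite:
  assumes "is_cdf F" "0 < p" "p < 1"
  shows "quantile F p = ereal (Inf {x. p \<le> F x})"
proof -
  obtain M where M: "real_distribution M" and F: "F = cdf M"
    using assms(1) unfolding is_cdf_def by blast
  interpret real_distribution M by (rule M)
  have "eventually (\<lambda>x. p < F x) at_top"
    using order_tendstoD(1)[OF cdf_lim_at_top_prob \<open>p < 1\<close>] F by simp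
  then obtain a where a: "p < F a"
    using eventually_happens'[OF trivial_limit_at_top_linorder] by blast
  have "eventually (\<lambda>x. F x < p) at_bot"
    using order_tendstoD(2)[OF cdf_lim_at_bot \<open>0 < p\<close>] F by simp
  then obtain b where b: "F b < p"
    using eventually_happens'[OF trivial_limit_at_bot_linorder] by blast
  have lb: "b \<le> x" if "p \<le> F x" for x
  proof (rule ccontr)
    assume "\<not> b \<le> x"
    then have "F x \<le> F b" using F cdf_nondecreasing[of x b] by simp
    with b that show False by simp
  qed
  let ?S = "{x. p \<le> F x}"
  have ne: "?S \<noteq> {}" using a by (auto intro: less_imp_le)
  have bdd: "bdd_below ?S" using lb by (intro bdd_belowI[of _ b]) auto
  have "ereal b \<le> Inf (ereal ` ?S)" using lb by (auto intro!: Inf_greatest)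
  moreover have "Inf (ereal ` ?S) \<le> ereal a" using a by (auto intro!: Inf_lower)
  ultimately have "\<bar>Inf (ereal ` ?S)\<bar> \<noteq> \<infinity>"
    by (cases "Inf (ereal ` ?S)") auto
  then have "ereal (Inf ?S) = Inf (ereal ` ?S)"
    by (rule ereal_Inf)
  then show ?thesis using assms(2) by (simp add: quantile_def)
qed

end

theory Submission
  imports Defs
begin

text \<open>For every cdf, \<open>\<integral>\<^sub>p\<^sup>1 F\<inverse>(u) du = (1 - p) a + \<integral> (1 - F(x)) dx\<close>, the last integral running from
  \<open>a = F\<inverse>(p)\<close> to \<open>\<infinity>\<close>. Subtract this from the same identity for \<open>G\<close> with \<open>b = G\<inverse>(p)\<close>, and move the lower
  limit of the integral of \<open>1 - G\<close> from \<open>b\<close> to \<open>a\<close>: the remainder is what is left between \<open>b\<close>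
  and \<open>a\<close>. Its bounds hold pointwise under the integral because \<open>F\<inverse>(p) \<le> x\<close> iff \<open>p \<le> F(x)\<close>.\<close>

lemma is_cdf_mono: "is_cdf F \<Longrightarrow> mono F"
  by (auto simp: is_cdf_def mono_def
      intro!: finite_borel_measure.cdf_nondecreasing real_distribution.finite_borel_measure_M)

lemma is_cdf_measurable: "is_cdf F \<Longrightarrow> F \<in> borel_measurable borel"
  by (simp add: borel_measurable_mono is_cdf_mono)

lemma is_cdf_bounds:
  assumes "is_cdf F"
  shows "0 \<le> F x" "F x \<le> 1"
proof -
  obtain M where M: "real_distribution M" and F: "F = cdf M"
    using assms unfolding is_cdf_def by blast
  interpret real_distribution M by (rule M)
  show "0 \<le> F x" "F x \<le> 1" unfolding F by (auto simp: cdf_nonneg cdf_bounded_prob)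
qed

text \<open>Right continuity puts the infimum itself into \<open>?S\<close>: if
  \<open>Inf ?S \<le> x\<close>, every \<open>y > x\<close> lies above some member of
  \<open>?S\<close>, so \<open>u \<le> F y\<close> by monotonicity, and \<open>y\<close> may tend to
  \<open>x\<close> from the right.\<close>

lemma quantile_le_iff:
  assumes "is_cdf F" "0 < u" "u < 1"
  shows "real_of_ereal (quantile F u) \<le> x \<longleftrightarrow> u \<le> F x"
proof -
  obtain M where M: "real_distribution M" and F: "F = cdf M"
    using assms(1) unfolding is_cdf_def by blast
  interpret real_distribution M by (rule M)
  let ?S = "{x. u \<le> F x}"
  have q: "real_of_ereal (quantile F u) = Inf ?S"
    using quantile_finite[OF assms] by simp
  have "eventually (\<lambda>x. u < F x) at_top"
    using order_tendstoD(1)[OF cdf_lim_at_top_prob \<open>u < 1\<close>] F by simp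
  then obtain a where a: "u < F a"
    using eventually_happens'[OF trivial_limit_at_top_linorder] by blast
  have "eventually (\<lambda>x. F x < u) at_bot"
    using order_tendstoD(2)[OF cdf_lim_at_bot \<open>0 < u\<close>] F by simp
  then obtain b where b: "F b < u"
    using eventually_happens'[OF trivial_limit_at_bot_linorder] by blast
  have ne: "?S \<noteq> {}" using a by (auto intro: less_imp_le)
  have bdd: "bdd_below ?S"
    using b monoD[OF is_cdf_mono[OF assms(1)]] by (intro bdd_belowI[of _ b]) (smt (verit) mem_Collect_eq)
  have "u \<le> F x" if le: "Inf ?S \<le> x"
  proof (rule tendsto_lowerbound)
    show "(F \<longlongrightarrow> F x) (at_right x)"
      using cdf_is_right_cont[of x] unfolding F continuous_within .
    have "u \<le> F y" if "x < y" for y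
    proof -
      obtain s where "s \<in> ?S" "s < y"
        using cInf_lessD[OF ne, of y] le \<open>x < y\<close> by auto
      then show ?thesis using monoD[OF is_cdf_mono[OF assms(1)], of s y] by simp
    qed
    then show "\<forall>\<^sub>F y in at_right x. u \<le> F y"
      by (auto simp: eventually_at_filter)
  qed simp
  then show ?thesis
    unfolding q using cInf_lower[OF _ bdd, of x] by auto
qed

text \<open>Both sides measure the region between the levels \<open>p\<close> and \<open>1\<close>, to the right of the
  \<open>p\<close>-quantile and above the graph of \<open>F\<close>, sliced in the two directions.\<close>
lemma tail_quantile_integral:
  fixes p :: real
  assumes F: "is_cdf F" and p: "0 < p" "p < 1"
    and int: "set_integrable lborel {p<..<1} (\<lambda>u. real_of_ereal (quantile F u))"
  defines "a \<equiv> real_of_ereal (quantile F p)"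
  shows "set_integrable lborel {a<..} (\<lambda>x. 1 - F x)"
    and "(LBINT u:{p<..<1}. real_of_ereal (quantile F u))
           = (1 - p) * a + (LBINT x:{a<..}. 1 - F x)"
proof -
  let ?Q = "\<lambda>u. real_of_ereal (quantile F u)"
  note [measurable] = is_cdf_measurable[OF F]
  define f where "f u = indicator {p<..<1} u * (?Q u - a)" for u
  define g where "g x = indicator {a<..} x * (1 - F x)" for x
  have const: "set_integrable lborel {p<..<1} (\<lambda>u. a)"
    using p by (simp add: set_integrable_def)
  have fint: "integrable lborel f"
    using set_integral_diff(1)[OF int const] by (simp add: set_integrable_def f_def[abs_def])
  have fLB: "integral\<^sup>L lborel f = (LBINT u:{p<..<1}. ?Q u) - (1 - p) * a"
    using set_integral_diff(2)[OF int const] p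
    by (simp add: set_lebesgue_integral_def f_def[abs_def])
  have aQ: "a \<le> ?Q u" if "p < u" "u < 1" for u
  proof -
    have "u \<le> F (?Q u)" using quantile_le_iff[OF F, of u "?Q u"] that p by simp
    then show ?thesis unfolding a_def using quantile_le_iff[OF F p, of "?Q u"] that by simp
  qed
  have f0: "0 \<le> f u" for u using aQ by (auto simp: f_def indicator_def)
  have g0: "0 \<le> g x" for x using is_cdf_bounds[OF F] by (auto simp: g_def indicator_def)
  \<comment> \<open>The region, with level first and abscissa second. Its section at level
    \<open>u\<close> is the interval from \<open>a\<close> to \<open>?Q u\<close>, of length
    \<open>f u\<close>; its section at \<open>x\<close> is the interval from \<open>F x\<close> to
    1, of length \<open>g x\<close>.\<close>
  define R where "R = {z :: real \<times> real. p < fst z \<and> fst z < 1 \<and> a < snd z \<and> F (snd z) < fst z}"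
  have [measurable]: "R \<in> sets (lborel \<Otimes>\<^sub>M lborel)"
  proof -
    have "{z \<in> space (lborel \<Otimes>\<^sub>M lborel). p < fst z \<and> fst z < (1::real) \<and> a < snd z \<and> F (snd z) < fst z}
        \<in> sets (lborel \<Otimes>\<^sub>M lborel)" by measurable
    then show ?thesis by (simp add: R_def space_pair_measure)
  qed
  have inner1: "(\<integral>\<^sup>+x. indicator R (u, x) \<partial>lborel) = ennreal (f u)" for u
  proof (cases "p < u \<and> u < 1")
    case True
    then have *: "F x < u \<longleftrightarrow> x < ?Q u" for x
      using quantile_le_iff[OF F, of u x] p by auto
    have "(\<integral>\<^sup>+x. indicator R (u, x) \<partial>lborel) = (\<integral>\<^sup>+x. indicator {a<..<?Q u} x \<partial>lborel)"
      by (intro nn_integral_cong) (auto simp: R_def indicator_def True *)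
    then show ?thesis using aQ True by (simp add: f_def[abs_def])
  qed (auto simp: R_def f_def indicator_def)
  have inner2: "(\<integral>\<^sup>+u. indicator R (u, x) \<partial>lborel) = ennreal (g x)" for x
  proof (cases "a < x")
    case True
    \<comment> \<open>Right of \<open>a\<close> the constraint \<open>p < u\<close> already follows
      from \<open>F x < u\<close>.\<close>
    then have "p \<le> F x" using quantile_le_iff[OF F p, of x] unfolding a_def by simp
    then have "(\<integral>\<^sup>+u. indicator R (u, x) \<partial>lborel) = (\<integral>\<^sup>+u. indicator {F x<..<1} u \<partial>lborel)"
      by (intro nn_integral_cong) (auto simp: R_def indicator_def True)
    then show ?thesis using is_cdf_bounds[OF F] True by (simp add: g_def[abs_def])
  qed (auto simp: R_def g_def indicator_def)
  have eq: "(\<integral>\<^sup>+x. ennreal (g x) \<partial>lborel) = (\<integral>\<^sup>+u. ennreal (f u) \<partial>lborel)"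
    using lborel_pair.Fubini'[of "\<lambda>u x. indicator R (u, x)"] by (simp add: inner1 inner2)
  also have "\<dots> = ennreal (integral\<^sup>L lborel f)"
    using fint f0 by (intro nn_integral_eq_integral) auto
  finally have nn: "(\<integral>\<^sup>+x. ennreal (g x) \<partial>lborel) = ennreal (integral\<^sup>L lborel f)" .
  have [measurable]: "g \<in> borel_measurable lborel" unfolding g_def[abs_def] by measurable
  \<comment> \<open>Convergence of the tail integral is obtained here: \<open>g\<close> is
    nonnegative and, by Tonelli, has the same finite integral as \<open>f\<close>.\<close>
  have gint: "integrable lborel g"
    using nn g0 by (intro integrableI_nonneg) auto
  show "set_integrable lborel {a<..} (\<lambda>x. 1 - F x)"
    using gint by (simp add: set_integrable_def g_def[abs_def])
  have "integral\<^sup>L lborel g = integral\<^sup>L lborel f"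
    using nn g0 f0 gint nn_integral_eq_integral[OF gint] by (simp add: integral_nonneg_AE)
  then show "(LBINT u:{p<..<1}. ?Q u) = (1 - p) * a + (LBINT x:{a<..}. 1 - F x)"
    using fLB by (simp add: set_lebesgue_integral_def g_def[abs_def])
qed

lemma interval_integrable_bounded:
  fixes f :: "real \<Rightarrow> real" and a b :: real
  assumes [measurable]: "f \<in> borel_measurable borel" and "\<And>x. \<bar>f x\<bar> \<le> B"
  shows "interval_lebesgue_integrable lborel a b f"
proof -
  have "set_integrable lborel {c<..<d} f" for c d
  proof (unfold set_integrable_def, rule Bochner_Integration.integrable_bound)
    show "integrable lborel (\<lambda>x. indicator {c<..<d} x * B)"
      by (intro integrable_mult_left) (cases "c \<le> d"; simp)
    show "AE x in lborel. norm (indicator {c<..<d} x *\<^sub>R f x) \<le> norm (indicator {c<..<d} x * B)"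
      using assms(2) by (intro AE_I2) (auto simp: indicator_def intro: order_trans[OF _ abs_ge_self])
  qed measurable
  then show ?thesis by (simp add: interval_lebesgue_integrable_def)
qed

text \<open>Swapping the limits negates both integrals, so the pointwise inequality must be reversed
  when \<open>b < a\<close>. This treats both orders of the two quantiles at once.\<close>

lemma interval_integral_mono_oriented:
  fixes f g :: "real \<Rightarrow> real" and a b :: real
  assumes "interval_lebesgue_integrable lborel a b f" "interval_lebesgue_integrable lborel a b g"
    and "\<And>x. a < x \<Longrightarrow> x < b \<Longrightarrow> f x \<le> g x"
    and "\<And>x. b < x \<Longrightarrow> x < a \<Longrightarrow> g x \<le> f x"
  shows "(LBINT x=a..b. f x) \<le> (LBINT x=a..b. g x)"
  using assms
  by (auto simp: interval_lebesgue_integral_def interval_lebesgue_integrable_def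
      intro!: set_integral_mono split: if_splits)

theorem theorem3p1:
  fixes p :: real and F G :: "real \<Rightarrow> real"
  assumes "0 < p" and "p < 1"
    and "F \<in> F1plus" and "G \<in> F1plus"
  shows "interval_lebesgue_integrable lborel (ereal p) 1
           (\<lambda>u. real_of_ereal (quantile G u) - real_of_ereal (quantile F u))
    \<and> interval_lebesgue_integrable lborel (quantile F p) \<infinity> (\<lambda>x. F x - G x)
    \<and> (LBINT u=ereal p..1. real_of_ereal (quantile G u) - real_of_ereal (quantile F u))
           = (LBINT x=quantile F p..\<infinity>. F x - G x) - Rem p F G
    \<and> 0 \<le> Rem p F G
    \<and> Rem p F G \<le> (LBINT x=quantile G p..quantile F p. G x - F x)
    \<and> (LBINT x=quantile G p..quantile F p. G x - F x)
           \<le> \<bar>real_of_ereal (quantile G p) - real_of_ereal (quantile F p)\<bar> * (SUP x. \<bar>G x - F x\<bar>)"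
proof -
  note p = assms(1,2)
  have F: "is_cdf F" and G: "is_cdf G" using assms(3,4) by (auto simp: F1plus_def)
  note [measurable] = is_cdf_measurable[OF F] is_cdf_measurable[OF G]
  note bds = is_cdf_bounds[OF F] is_cdf_bounds[OF G]
  let ?QF = "\<lambda>u. real_of_ereal (quantile F u)" and ?QG = "\<lambda>u. real_of_ereal (quantile G u)"
  define a where "a = ?QF p"
  define b where "b = ?QG p"
  have qF: "quantile F p = ereal a" and qG: "quantile G p = ereal b"
    unfolding a_def b_def using quantile_finite[OF F p] quantile_finite[OF G p] by simp_all
  have aF: "a \<le> x \<longleftrightarrow> p \<le> F x" and bG: "b \<le> x \<longleftrightarrow> p \<le> G x" for x
    unfolding a_def b_def by (rule quantile_le_iff[OF F p] quantile_le_iff[OF G p])+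
  \<comment> \<open>Passing to the open interval drops the endpoint 1, where
    \<open>real_of_ereal\<close> may replace an infinite quantile by 0.\<close>
  have intF: "set_integrable lborel {p<..<1} ?QF" and intG: "set_integrable lborel {p<..<1} ?QG"
    using assms by (auto simp: F1plus_def intro: set_integrable_subset[of _ "{p..1}"])
  note tF = tail_quantile_integral[OF F p intF, folded a_def]
  note tG = tail_quantile_integral[OF G p intG, folded b_def]
  have bd: "interval_lebesgue_integrable lborel (ereal c) (ereal d) f"
    if "f \<in> borel_measurable borel" "\<And>x. \<bar>f x\<bar> \<le> 1" for c d and f :: "real \<Rightarrow> real"
    using interval_integrable_bounded that by blast
  have iG1: "interval_lebesgue_integrable lborel (ereal b) (ereal a) (\<lambda>x. 1 - G x)"
    and iGp: "interval_lebesgue_integrable lborel (ereal b) (ereal a) (\<lambda>x. G x - p)"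
    and iGF: "interval_lebesgue_integrable lborel (ereal b) (ereal a) (\<lambda>x. G x - F x)"
    using p bds by (auto intro!: bd simp: abs_le_iff) (smt (verit))+
  have i0: "interval_lebesgue_integrable lborel (ereal b) (ereal a) (\<lambda>x. 0)"
    by (simp add: interval_lebesgue_integrable_def set_integrable_def)
  have tail_b: "set_integrable lborel {c<..} (\<lambda>x. 1 - G x)" for c
  proof -
    have "set_integrable lborel ({b<..} \<union> {c<..b}) (\<lambda>x. 1 - G x)"
    proof (rule set_integrable_Un[OF tG(1)])
      \<comment> \<open>Interval integrability concerns open intervals; ending at
        \<open>b + 1\<close> makes room for the point \<open>b\<close>.\<close>
      have "set_integrable lborel {c<..<b + 1} (\<lambda>x. 1 - G x)" if "c \<le> b"
        using bd[of "\<lambda>x. 1 - G x" c "b + 1"] bds that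
        by (simp add: interval_lebesgue_integrable_def)
      then show "set_integrable lborel {c<..b} (\<lambda>x. 1 - G x)"
        by (cases "c \<le> b") (auto intro: set_integrable_subset)
    qed auto
    then show ?thesis by (rule set_integrable_subset) auto
  qed
  \<comment> \<open>\<open>F\<close> and \<open>G\<close> tend to 1 and have no integrable tails, so
    \<open>F - G\<close> is handled as \<open>(1 - G) - (1 - F)\<close>.\<close>
  have iFG: "set_integrable lborel {a<..} (\<lambda>x. F x - G x)"
    and FG: "(LBINT x:{a<..}. F x - G x) = (LBINT x:{a<..}. 1 - G x) - (LBINT x:{a<..}. 1 - F x)"
    using set_integral_diff[OF tail_b[of a] tF(1)] by simp_all
  \<comment> \<open>Valid in either order of \<open>a\<close> and \<open>b\<close>; additivity needs
    integrability from the smaller of them onwards, hence the arbitrary \<open>c\<close> in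
    \<open>tail_b\<close>.\<close>
  have split: "(LBINT x:{b<..}. 1 - G x)
      = (LBINT x=ereal b..ereal a. 1 - G x) + (LBINT x:{a<..}. 1 - G x)"
  proof -
    have "(LBINT x=ereal b..ereal a. 1 - G x) + (LBINT x=ereal a..\<infinity>. 1 - G x)
        = (LBINT x=ereal b..\<infinity>. 1 - G x)"
      using tail_b by (intro interval_integral_sum)
        (auto simp: interval_lebesgue_integrable_def min_def max_def)
    then show ?thesis by (simp add: interval_integral_to_infinity_eq)
  qed
  \<comment> \<open>Write \<open>G x - p\<close> as \<open>(1 - p) - (1 - G x)\<close>. The
    right-hand side is then minus what remains in the difference of the two tail identities once
    \<open>split\<close> is applied and the tails beyond \<open>a\<close> are collected.\<close>
  have RemE: "Rem p F G = (1 - p) * (a - b) - (LBINT x=ereal b..ereal a. 1 - G x)"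
  proof -
    have "(LBINT x=ereal b..ereal a. (1 - p) - (1 - G x))
        = (LBINT x=ereal b..ereal a. 1 - p) - (LBINT x=ereal b..ereal a. 1 - G x)"
      by (intro interval_lebesgue_integral_diff(2) iG1) simp
    then show ?thesis by (simp add: Rem_def qF qG)
  qed
  have one_eq: "(1::ereal) = ereal 1" by simp
  have main: "(LBINT u=ereal p..1. ?QG u - ?QF u) = (LBINT x=ereal a..\<infinity>. F x - G x) - Rem p F G"
  proof -
    have "(LBINT u=ereal p..1. ?QG u - ?QF u) = (LBINT u:{p<..<1}. ?QG u) - (LBINT u:{p<..<1}. ?QF u)"
      using p set_integral_diff(2)[OF intG intF]
      by (simp add: interval_lebesgue_integral_def one_eq del: ereal_eq_1)
    also have "\<dots> = (LBINT x=ereal a..\<infinity>. F x - G x) - Rem p F G"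
      unfolding tF(2) tG(2) split RemE interval_integral_to_infinity_eq FG
      by (simp add: algebra_simps)
    finally show ?thesis .
  qed
  \<comment> \<open>\<open>G x - p\<close> is nonnegative to the right of \<open>b\<close> and
    negative to its left, so its sign agrees with the orientation from \<open>b\<close> to
    \<open>a\<close>.\<close>
  have Rem0: "0 \<le> Rem p F G"
    using interval_integral_mono_oriented[OF i0 iGp] bG
    by (force simp: Rem_def qF qG not_le[symmetric] dest: less_imp_le)
  \<comment> \<open>Replacing \<open>p\<close> by \<open>F x\<close> helps in both orders:
    \<open>F x < p\<close> to the left of \<open>a\<close>, and \<open>p \<le> F x\<close> to its
    right.\<close>
  have RemGF: "Rem p F G \<le> (LBINT x=ereal b..ereal a. G x - F x)"
    unfolding Rem_def qF qG
    by (rule interval_integral_mono_oriented[OF iGp iGF]) (use aF in \<open>smt (verit)\<close>)+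
  have "(LBINT x=ereal b..ereal a. G x - F x) \<le> \<bar>b - a\<bar> * (SUP x. \<bar>G x - F x\<bar>)"
  proof -
    let ?S = "SUP x. \<bar>G x - F x\<bar>"
    have "bdd_above (range (\<lambda>x. \<bar>G x - F x\<bar>))"
      using bds by (intro bdd_aboveI[of _ 1]) (auto simp: abs_le_iff, (smt (verit))+)
    then have S: "\<bar>G x - F x\<bar> \<le> ?S" for x by (intro cSUP_upper) auto
    \<comment> \<open>The sign of \<open>s\<close> follows the orientation, so the constant
      \<open>s\<close> integrates to \<open>s * (a - b) = \<bar>b - a\<bar> * ?S\<close> in both
      orders.\<close>
    define s where "s = (if b \<le> a then ?S else - ?S)"
    have "(LBINT x=ereal b..ereal a. G x - F x) \<le> (LBINT x=ereal b..ereal a. s)"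
      using S by (intro interval_integral_mono_oriented[OF iGF]) (auto simp: s_def abs_le_iff minus_le_iff)
    also have "\<dots> = \<bar>b - a\<bar> * ?S" by (auto simp: s_def algebra_simps)
    finally show ?thesis .
  qed
  moreover have "interval_lebesgue_integrable lborel (ereal p) 1 (\<lambda>u. ?QG u - ?QF u)"
    using p set_integral_diff(1)[OF intG intF]
    by (simp add: interval_lebesgue_integrable_def one_eq del: ereal_eq_1)
  moreover have "interval_lebesgue_integrable lborel (ereal a) \<infinity> (\<lambda>x. F x - G x)"
    using iFG by (simp add: interval_lebesgue_integrable_def)
  ultimately show ?thesis
    using main Rem0 RemGF by (simp add: qF qG)
qed

end
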